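(* Let $\mathcal{X}$ be a finite set, let $\pi$ be a probability measure on $\mathcal{X}$ with strictly positive masses, and let $P$ be a $\pi$-reversible transition matrix on $\mathcal{X}$. Let $\phi(t)=t\log t$ (with $\phi(0)=0$) and, for $S\subseteq\mathcal{X}$ with complement $S'$, let $$T(S)=\sum_{x\in\mathcal{X}}\pi(x)\big[\phi(P(x,S))+\phi(P(x,S'))\big],\qquad U(S)=\phi(\pi(S))+\phi(\pi(S')).$$ Then $T$ and $U$ are supermodular set functions, and for every $S\ne\emptyset,\mathcal{X}$, $$D_{\mathrm{KL}}^\pi(PG_S\,\|\,\Pi)=T(S)-U(S),\qquad U(S)=-H(\overline{\pi}),$$ where $\overline{\pi}=(\pi(S),\pi(S'))$. Thus $S\mapsto D_{\mathrm{KL}}^\pi(PG_S\|\Pi)$ can be written as a difference of two supermodular set functions, and equivalently as a difference of two submodular set functions.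
   Context: $P(x,S)=\sum_{y\in S}P(x,y)$ and $\pi(S)=\sum_{y\in S}\pi(y)$. $G_S$ is the Gibbs kernel of the partition $\mathcal{X}=S\sqcup S'$: $G_S(x,y)=\pi(y)/\pi(S)$ if $x,y\in S$, $\pi(y)/\pi(S')$ if $x,y\in S'$, and $0$ otherwise. $\Pi$ is the matrix all of whose rows equal $\pi$. $D^\pi_{\mathrm{KL}}(A\|B)=\sum_{x,y}\pi(x)A(x,y)\log\frac{A(x,y)}{B(x,y)}$, with $0\log(0/a)=0$. Shannon entropy: $H(\mu)=-\sum_x\mu(x)\log\mu(x)$. A set function $F:2^{\mathcal{X}}\to\mathbb{R}$ is submodular if $F(A\cap B)+F(A\cup B)\le F(A)+F(B)$ for all $A,B\subseteq\mathcal{X}$, and supermodular if $-F$ is submodular. *)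

theory Defs
  imports "HOL-Analysis.Analysis"
begin

text \<open>
  The finite state space is a type \<open>'a :: finite\<close>. Measures on it are row vectors \<open>real ^ 'a\<close> and
  kernels are matrices \<open>real ^ 'a ^ 'a\<close>, where \<open>P $ x $ y\<close> is the entry \<open>P(x, y)\<close>, so that
  composition of kernels is the matrix product \<open>**\<close>. Logarithms are natural.
\<close>

definition positive_prob_vec :: "real ^ 'a::finite \<Rightarrow> bool" where
  "positive_prob_vec \<pi> \<longleftrightarrow> (\<forall>x. 0 < \<pi> $ x) \<and> (\<Sum>x\<in>UNIV. \<pi> $ x) = 1"

definition transition_matrix :: "real ^ 'a ^ 'a::finite \<Rightarrow> bool" where
  "transition_matrix P \<longleftrightarrow> (\<forall>x y. 0 \<le> P $ x $ y) \<and> (\<forall>x. (\<Sum>y\<in>UNIV. P $ x $ y) = 1)"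

definition reversible :: "real ^ 'a \<Rightarrow> real ^ 'a ^ 'a::finite \<Rightarrow> bool" where
  "reversible \<pi> P \<longleftrightarrow> (\<forall>x y. \<pi> $ x * P $ x $ y = \<pi> $ y * P $ y $ x)"

text \<open>\<open>mass \<pi> S\<close> is \<open>\<pi>(S)\<close>; since rows of kernels are vectors, \<open>mass (P $ x) S\<close> is \<open>P(x, S)\<close>.\<close>

definition mass :: "real ^ 'a::finite \<Rightarrow> 'a set \<Rightarrow> real" where
  "mass \<mu> S = (\<Sum>y\<in>S. \<mu> $ y)"

definition gibbs_kernel :: "real ^ 'a \<Rightarrow> 'a set \<Rightarrow> real ^ 'a ^ 'a::finite" where
  "gibbs_kernel \<pi> S =
     (\<chi> x y. if x \<in> S \<and> y \<in> S then \<pi> $ y / mass \<pi> S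
            else if x \<in> - S \<and> y \<in> - S then \<pi> $ y / mass \<pi> (- S)
            else 0)"

definition const_kernel :: "real ^ 'a \<Rightarrow> real ^ 'a ^ 'a::finite" where
  "const_kernel \<pi> = (\<chi> x. \<pi>)"

text \<open>
  The convention \<open>0 log(0/a) = 0\<close> holds because of the factor \<open>A $ x $ y\<close>. Being real-valued, this
  is the divergence only when \<open>B $ x $ y = 0\<close> implies \<open>A $ x $ y = 0\<close> (otherwise the divergence is
  infinite); this is the case for \<open>B = const_kernel \<pi>\<close> with \<open>\<pi>\<close> strictly positive.
\<close>

definition KL_div :: "real ^ 'a \<Rightarrow> real ^ 'a ^ 'a \<Rightarrow> real ^ 'a ^ 'a::finite \<Rightarrow> real" where
  "KL_div \<pi> A B =
     (\<Sum>x\<in>UNIV. \<Sum>y\<in>UNIV. \<pi> $ x * A $ x $ y * ln (A $ x $ y / B $ x $ y))"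

definition shannon_entropy :: "real ^ 'n::finite \<Rightarrow> real" where
  "shannon_entropy \<mu> = - (\<Sum>x\<in>UNIV. \<mu> $ x * ln (\<mu> $ x))"

definition submodular :: "('a set \<Rightarrow> real) \<Rightarrow> bool" where
  "submodular F \<longleftrightarrow> (\<forall>A B. F (A \<inter> B) + F (A \<union> B) \<le> F A + F B)"

definition supermodular :: "('a set \<Rightarrow> real) \<Rightarrow> bool" where
  "supermodular F \<longleftrightarrow> submodular (\<lambda>S. - F S)"

text \<open>\<open>\<phi>(0) = 0\<close> holds because of the factor \<open>t\<close>.\<close>

definition phi :: "real \<Rightarrow> real" where
  "phi t = t * ln t"

definition T_fun :: "real ^ 'a \<Rightarrow> real ^ 'a ^ 'a \<Rightarrow> 'a::finite set \<Rightarrow> real" where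
  "T_fun \<pi> P S = (\<Sum>x\<in>UNIV. \<pi> $ x * (phi (mass (P $ x) S) + phi (mass (P $ x) (- S))))"

definition U_fun :: "real ^ 'a \<Rightarrow> 'a::finite set \<Rightarrow> real" where
  "U_fun \<pi> S = phi (mass \<pi> S) + phi (mass \<pi> (- S))"

end

theory Submission
  imports Defs
begin

text \<open>
  Since \<open>\<phi>\<close> is convex on \<open>[0, \<infinity>)\<close>, \<open>S \<mapsto> \<phi>(\<mu>(S))\<close> is supermodular for every nonnegative \<open>\<mu>\<close>;
  complementation swaps unions with intersections, so \<open>S \<mapsto> \<phi>(\<mu>(S'))\<close> is supermodular too. This
  settles \<open>U\<close>, and \<open>T\<close> is a nonnegative combination of such functions. For \<open>y\<close> in a block \<open>S\<close> one has
  \<open>(P G\<^sub>S)(x, y) / \<pi>(y) = P(x, S) / \<pi>(S)\<close>, so the block contributes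
  \<open>\<Sum>\<^sub>x \<pi>(x) P(x, S) log (P(x, S) / \<pi>(S))\<close>, and the part with \<open>log \<pi>(S)\<close> sums to \<open>\<phi>(\<pi>(S))\<close>
  because \<open>\<pi>\<close> is stationary for \<open>P\<close>.
\<close>

text \<open>The slope \<open>1 + ln s\<close> is the derivative of \<open>phi\<close> at
  \<open>s\<close>. For \<open>t > 0\<close> the bound is \<open>ln r \<le> r - 1\<close> at
  \<open>r = s / t\<close>, multiplied by \<open>t\<close>; for \<open>t = 0\<close> the left side
  is \<open>- s\<close>.\<close>

lemma phi_above_tangent:
  assumes "0 \<le> t" "0 < s"
  shows "phi s + (1 + ln s) * (t - s) \<le> phi t"
proof (cases "t = 0")
  case True
  then show ?thesis using assms by (simp add: phi_def algebra_simps)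
next
  case False
  then have t: "t > 0" using assms by simp
  have "ln (s / t) \<le> s / t - 1"
    using assms t by (intro ln_le_minus_one) simp
  then have "t * (ln s - ln t) \<le> t * (s / t - 1)"
    using assms t by (simp add: ln_div)
  also have "\<dots> = s - t" using t by (simp add: field_simps)
  finally show ?thesis by (simp add: phi_def algebra_simps)
qed

text \<open>Tangents are used because the interval contains 0, where \<open>phi\<close> has no
  finite slope. Averaging the tangent bounds at the convex combination \<open>z\<close> cancels the
  linear term.\<close>

lemma convex_on_phi: "convex_on {0..} phi"
proof (rule convex_onI)
  fix t x y :: real
  assume t: "0 < t" "t < 1" and xy: "x \<in> {0..}" "y \<in> {0..}"
  define z where "z = (1 - t) * x + t * y"
  have nonneg: "0 \<le> (1 - t) * x" "0 \<le> t * y" using t xy by auto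
  show "phi ((1 - t) *\<^sub>R x + t *\<^sub>R y) \<le> (1 - t) * phi x + t * phi y"
  \<comment> \<open>There is no tangent at \<open>z = 0\<close>, but then both nonnegative summands
    of \<open>z\<close> vanish, and with positive weights \<open>x = y = 0\<close>.\<close>
  proof (cases "z = 0")
    case True
    then have "(1 - t) * x = 0" "t * y = 0" using nonneg unfolding z_def by linarith+
    then show ?thesis using t by (simp add: phi_def)
  next
    case False
    then have z: "z > 0" using nonneg by (simp add: z_def)
    have "(1 - t) * (phi z + (1 + ln z) * (x - z)) + t * (phi z + (1 + ln z) * (y - z))
        \<le> (1 - t) * phi x + t * phi y"
      using t xy z by (intro add_mono mult_left_mono phi_above_tangent) auto
    moreover have "(1 - t) * (phi z + (1 + ln z) * (x - z)) + t * (phi z + (1 + ln z) * (y - z))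
        = phi z + (1 + ln z) * ((1 - t) * x + t * y - z)"
      by (simp add: algebra_simps)
    ultimately show ?thesis by (simp add: z_def)
  qed
qed simp

lemma convex_on_sum_inner_le_outer:
  fixes f :: "real \<Rightarrow> real"
  assumes f: "convex_on I f" and I: "i \<in> I" "u \<in> I"
    and le: "i \<le> a" "a \<le> u" and eq: "a + b = i + u"
  shows "f a + f b \<le> f i + f u"
proof (cases "i = u")
  case True
  then show ?thesis using le eq by auto
next
  case False
  then have iu: "i < u" using le by simp
  \<comment> \<open>\<open>t\<close> is the relative position of \<open>a\<close> between
    \<open>i\<close> and \<open>u\<close>. As \<open>a + b = i + u\<close>, the point
    \<open>b\<close> carries the same two weights swapped, so adding the two convexity bounds leaves
    total weight 1 on each endpoint.\<close>
  define t where "t = (a - i) / (u - i)"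
  have t: "0 \<le> t" "t \<le> 1" using le iu by (auto simp: t_def)
  have "t * (u - i) = a - i" using iu by (simp add: t_def)
  then have a: "a = (1 - t) *\<^sub>R i + t *\<^sub>R u" by (simp add: algebra_simps)
  have b: "b = (1 - t) *\<^sub>R u + t *\<^sub>R i"
    using a eq by (simp add: algebra_simps)
  have "f a \<le> (1 - t) * f i + t * f u" "f b \<le> (1 - t) * f u + t * f i"
    unfolding a b using t I by (intro convex_onD[OF f]; simp)+
  then show ?thesis by (simp add: algebra_simps)
qed

lemma mass_nonneg: "(\<And>x. 0 \<le> \<mu> $ x) \<Longrightarrow> 0 \<le> mass \<mu> S"
  by (simp add: mass_def sum_nonneg)

lemma mass_mono: "(\<And>x. 0 \<le> \<mu> $ x) \<Longrightarrow> A \<subseteq> B \<Longrightarrow> mass \<mu> A \<le> mass \<mu> B"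
  by (simp add: mass_def sum_mono2)

lemma mass_pos: "positive_prob_vec \<pi> \<Longrightarrow> S \<noteq> {} \<Longrightarrow> 0 < mass \<pi> S"
  by (auto simp: mass_def positive_prob_vec_def intro!: sum_pos)

lemma mass_Un_Int: "mass \<mu> A + mass \<mu> B = mass \<mu> (A \<inter> B) + mass \<mu> (A \<union> B)"
  using sum.union_inter[of A B "\<lambda>y. \<mu> $ y"] by (simp add: mass_def)

lemma supermodularI:
  "(\<And>A B. F A + F B \<le> F (A \<inter> B) + F (A \<union> B)) \<Longrightarrow> supermodular F"
  by (simp add: supermodular_def submodular_def algebra_simps)

lemma supermodularD: "supermodular F \<Longrightarrow> F A + F B \<le> F (A \<inter> B) + F (A \<union> B)"
  by (auto simp: supermodular_def submodular_def algebra_simps dest!: spec[of _ A] spec[of _ B])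

lemma supermodular_add:
  "supermodular F \<Longrightarrow> supermodular G \<Longrightarrow> supermodular (\<lambda>S. F S + G S)"
  using supermodularD[of F] supermodularD[of G]
  by (fastforce intro: supermodularI dest: add_mono simp: algebra_simps)

lemma supermodular_compl: "supermodular F \<Longrightarrow> supermodular (\<lambda>S. F (- S))"
  using supermodularD[of F "- A" "- B" for A B] by (intro supermodularI) (simp add: add.commute)

lemma supermodular_weighted_sum:
  assumes "\<And>x. x \<in> X \<Longrightarrow> 0 \<le> w x" "\<And>x. x \<in> X \<Longrightarrow> supermodular (F x)"
  shows "supermodular (\<lambda>S. \<Sum>x\<in>X. w x * F x S)"
proof (rule supermodularI)
  fix A B
  have "(\<Sum>x\<in>X. w x * (F x A + F x B)) \<le> (\<Sum>x\<in>X. w x * (F x (A \<inter> B) + F x (A \<union> B)))"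
    using assms by (intro sum_mono mult_left_mono supermodularD)
  then show "(\<Sum>x\<in>X. w x * F x A) + (\<Sum>x\<in>X. w x * F x B)
      \<le> (\<Sum>x\<in>X. w x * F x (A \<inter> B)) + (\<Sum>x\<in>X. w x * F x (A \<union> B))"
    by (simp add: distrib_left sum.distrib)
qed

text \<open>The masses of \<open>A \<inter> B\<close> and \<open>A \<union> B\<close> act as the
  outer pair: monotonicity puts the mass of \<open>A\<close> between them, and inclusion-exclusion
  makes the two sums agree.\<close>

lemma supermodular_phi_mass:
  assumes "\<And>x. 0 \<le> \<mu> $ x"
  shows "supermodular (\<lambda>S. phi (mass \<mu> S))"
proof (rule supermodularI)
  fix A B
  show "phi (mass \<mu> A) + phi (mass \<mu> B) \<le> phi (mass \<mu> (A \<inter> B)) + phi (mass \<mu> (A \<union> B))"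
    using assms
    by (intro convex_on_sum_inner_le_outer[OF convex_on_phi] mass_Un_Int)
      (auto intro: mass_nonneg mass_mono)
qed

lemma supermodular_phi_mass_pair:
  assumes "\<And>x. 0 \<le> \<mu> $ x"
  shows "supermodular (\<lambda>S. phi (mass \<mu> S) + phi (mass \<mu> (- S)))"
  using supermodular_phi_mass[OF assms] by (intro supermodular_add supermodular_compl)

lemma stationary_mass:
  assumes "transition_matrix P" "reversible \<pi> P"
  shows "(\<Sum>x\<in>UNIV. \<pi> $ x * mass (P $ x) S) = mass \<pi> S"
proof -
  have "(\<Sum>x\<in>UNIV. \<pi> $ x * mass (P $ x) S) = (\<Sum>y\<in>S. \<Sum>x\<in>UNIV. \<pi> $ x * P $ x $ y)"
    by (simp add: mass_def sum_distrib_left) (rule sum.swap)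
  \<comment> \<open>Detailed balance turns the column sum into a row sum, which is 1.\<close>
  also have "\<dots> = (\<Sum>y\<in>S. \<pi> $ y * (\<Sum>x\<in>UNIV. P $ y $ x))"
    using assms(2) by (simp add: reversible_def sum_distrib_left)
  finally show ?thesis using assms(1) by (simp add: mass_def transition_matrix_def)
qed

text \<open>The kernel depends only on the unordered partition, so a computation for one block
  serves for both.\<close>

lemma gibbs_kernel_compl: "gibbs_kernel \<pi> (- S) = gibbs_kernel \<pi> S"
  by (auto simp: gibbs_kernel_def vec_eq_iff)

text \<open>For \<open>y \<in> S\<close>, column \<open>y\<close> of the Gibbs kernel is constant on
  \<open>S\<close> and zero off \<open>S\<close>.\<close>

lemma matrix_mul_gibbs_kernel:
  assumes "y \<in> S"
  shows "(P ** gibbs_kernel \<pi> S) $ x $ y = mass (P $ x) S * (\<pi> $ y / mass \<pi> S)"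
proof -
  have "(P ** gibbs_kernel \<pi> S) $ x $ y
      = (\<Sum>z\<in>UNIV. if z \<in> S then P $ x $ z * (\<pi> $ y / mass \<pi> S) else 0)"
    using assms unfolding matrix_matrix_mult_def gibbs_kernel_def
    by (simp, intro sum.cong) auto
  also have "\<dots> = (\<Sum>z\<in>S. P $ x $ z * (\<pi> $ y / mass \<pi> S))"
    by (simp add: sum.If_cases)
  finally show ?thesis by (simp add: mass_def sum_distrib_right sum_divide_distrib)
qed

lemma KL_div_block:
  assumes \<pi>: "positive_prob_vec \<pi>" and P: "transition_matrix P" "reversible \<pi> P"
  shows "(\<Sum>x\<in>UNIV. \<Sum>y\<in>S. \<pi> $ x * (P ** gibbs_kernel \<pi> S) $ x $ y *
            ln ((P ** gibbs_kernel \<pi> S) $ x $ y / const_kernel \<pi> $ x $ y))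
       = (\<Sum>x\<in>UNIV. \<pi> $ x * phi (mass (P $ x) S)) - phi (mass \<pi> S)"
\<comment> \<open>Both sides are 0 here. Covering this case gives the divergence formula for every
  \<open>S\<close>, as the existential claims of the theorem demand.\<close>
proof (cases "S = {}")
  case True
  then show ?thesis by (simp add: mass_def phi_def)
next
  case False
  then have S: "mass \<pi> S > 0" using \<pi> by (rule mass_pos[rotated])
  have row: "(\<Sum>y\<in>S. \<pi> $ x * (P ** gibbs_kernel \<pi> S) $ x $ y *
        ln ((P ** gibbs_kernel \<pi> S) $ x $ y / const_kernel \<pi> $ x $ y))
      = \<pi> $ x * phi (mass (P $ x) S) - \<pi> $ x * mass (P $ x) S * ln (mass \<pi> S)" for x
  proof -
    define p where "p = mass (P $ x) S"
    have p: "0 \<le> p" using P(1) by (auto simp: p_def transition_matrix_def intro: mass_nonneg)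
    have "(\<Sum>y\<in>S. \<pi> $ x * (P ** gibbs_kernel \<pi> S) $ x $ y *
          ln ((P ** gibbs_kernel \<pi> S) $ x $ y / const_kernel \<pi> $ x $ y))
        = (\<Sum>y\<in>S. \<pi> $ y * (\<pi> $ x * p * ln (p / mass \<pi> S) / mass \<pi> S))"
    proof (rule sum.cong[OF refl])
      fix y assume y: "y \<in> S"
      have "\<pi> $ y > 0" using \<pi> by (simp add: positive_prob_vec_def)
      \<comment> \<open>The argument of the logarithm is thus independent of \<open>y\<close>, and
        summing the remaining factor \<open>\<pi> $ y\<close> over \<open>S\<close> gives
        \<open>mass \<pi> S\<close>.\<close>
      then have "p * (\<pi> $ y / mass \<pi> S) / \<pi> $ y = p / mass \<pi> S" by simp
      then show "\<pi> $ x * (P ** gibbs_kernel \<pi> S) $ x $ y *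
          ln ((P ** gibbs_kernel \<pi> S) $ x $ y / const_kernel \<pi> $ x $ y)
        = \<pi> $ y * (\<pi> $ x * p * ln (p / mass \<pi> S) / mass \<pi> S)"
        unfolding matrix_mul_gibbs_kernel[OF y]
        by (simp add: const_kernel_def flip: p_def)
    qed
    also have "\<dots> = mass \<pi> S * (\<pi> $ x * p * ln (p / mass \<pi> S) / mass \<pi> S)"
      by (simp only: mass_def sum_distrib_right)
    also have "\<dots> = \<pi> $ x * (p * ln (p / mass \<pi> S))" using S by simp
    also have "p * ln (p / mass \<pi> S) = phi p - p * ln (mass \<pi> S)"
      using p S by (cases "p = 0") (simp_all add: phi_def ln_div algebra_simps)
    finally show ?thesis by (simp add: p_def algebra_simps)
  qed
  show ?thesis
    unfolding row sum_subtractf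
    by (simp add: stationary_mass[OF P] phi_def flip: sum_distrib_right)
qed

lemma KL_div_gibbs_eq_T_minus_U:
  assumes "positive_prob_vec \<pi>" "transition_matrix P" "reversible \<pi> P"
  shows "KL_div \<pi> (P ** gibbs_kernel \<pi> S) (const_kernel \<pi>) = T_fun \<pi> P S - U_fun \<pi> S"
proof -
  let ?f = "\<lambda>x y. \<pi> $ x * (P ** gibbs_kernel \<pi> S) $ x $ y *
      ln ((P ** gibbs_kernel \<pi> S) $ x $ y / const_kernel \<pi> $ x $ y)"
  have "sum (?f x) UNIV = sum (?f x) S + sum (?f x) (- S)" for x
    using sum.union_disjoint[of S "- S" "?f x"] by simp
  then have "KL_div \<pi> (P ** gibbs_kernel \<pi> S) (const_kernel \<pi>)
      = (\<Sum>x\<in>UNIV. sum (?f x) S) + (\<Sum>x\<in>UNIV. sum (?f x) (- S))"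
    by (simp add: KL_div_def sum.distrib)
  then show ?thesis
    using KL_div_block[OF assms, of S] KL_div_block[OF assms, of "- S"]
    by (simp add: gibbs_kernel_compl T_fun_def U_fun_def distrib_left sum.distrib)
qed

theorem proposition6p1:
  fixes \<pi> :: "real ^ 'a::finite" and P :: "real ^ 'a ^ 'a"
  assumes "positive_prob_vec \<pi>"
    and "transition_matrix P"
    and "reversible \<pi> P"
  shows "supermodular (T_fun \<pi> P)
    \<and> supermodular (U_fun \<pi>)
    \<and> (\<forall>S. S \<noteq> {} \<and> S \<noteq> UNIV \<longrightarrow>
          KL_div \<pi> (P ** gibbs_kernel \<pi> S) (const_kernel \<pi>) = T_fun \<pi> P S - U_fun \<pi> S
        \<and> U_fun \<pi> S = - shannon_entropy (vector [mass \<pi> S, mass \<pi> (- S)] :: real ^ 2))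
    \<and> (\<exists>F G. supermodular F \<and> supermodular G \<and>
          (\<forall>S. KL_div \<pi> (P ** gibbs_kernel \<pi> S) (const_kernel \<pi>) = F S - G S))
    \<and> (\<exists>F G. submodular F \<and> submodular G \<and>
          (\<forall>S. KL_div \<pi> (P ** gibbs_kernel \<pi> S) (const_kernel \<pi>) = F S - G S))"
proof -
  have \<pi>: "0 \<le> \<pi> $ x" for x
    using assms(1) by (simp add: positive_prob_vec_def less_imp_le)
  have P: "0 \<le> P $ x $ y" for x y
    using assms(2) by (simp add: transition_matrix_def)
  have T: "supermodular (T_fun \<pi> P)"
    unfolding T_fun_def using \<pi> P
    by (intro supermodular_weighted_sum supermodular_phi_mass_pair) auto
  have U: "supermodular (U_fun \<pi>)"
    unfolding U_fun_def using \<pi> by (rule supermodular_phi_mass_pair)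
  note KL = KL_div_gibbs_eq_T_minus_U[OF assms]
  have ent: "U_fun \<pi> S = - shannon_entropy (vector [mass \<pi> S, mass \<pi> (- S)] :: real ^ 2)" for S
    by (simp add: U_fun_def shannon_entropy_def phi_def sum_2)
  have "\<exists>F G. supermodular F \<and> supermodular G \<and>
      (\<forall>S. KL_div \<pi> (P ** gibbs_kernel \<pi> S) (const_kernel \<pi>) = F S - G S)"
    using T U KL by blast
  moreover have "\<exists>F G. submodular F \<and> submodular G \<and>
      (\<forall>S. KL_div \<pi> (P ** gibbs_kernel \<pi> S) (const_kernel \<pi>) = F S - G S)"
    using T U KL
    \<comment> \<open>Negation exchanges the roles: \<open>T - U = (- U) - (- T)\<close>.\<close>
    by (intro exI[of _ "\<lambda>S. - U_fun \<pi> S"] exI[of _ "\<lambda>S. - T_fun \<pi> P S"])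
      (simp add: supermodular_def)
  ultimately show ?thesis using T U KL ent by blast
qed

end
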